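(* For every proper minor-closed graph class $\mathcal{G}$ there exists a constant $c_{\mathcal{G}}$ such that every graph $G\in\mathcal{G}$ satisfies $\chi_{\mathrm{so}}(G)\leq c_{\mathcal{G}}$.
   Context: All graphs are finite and simple. A graph class is minor-closed if it is closed under taking minors, and proper if it is not the class of all graphs. A proper vertex-coloring $\varphi\colon V(G)\to[t]$ of a graph $G$ is \emph{strong odd} if for every vertex $v\in V(G)$ and every color $i\in[t]$ the number $|N(v)\cap\varphi^{-1}(i)|$ is either zero or odd; $\chi_{\mathrm{so}}(G)$ is the minimum $t$ such that $G$ admits a strong odd coloring with $t$ colors. *)

theory Defs
  imports "Graph_Theory.Digraph_Component"
begin

text \<open>
  Finite simple graphs are the symmetric loop-free finite digraphs without parallel arcs, i.e.
  the \<^locale>\<open>pair_graph\<close>s: an edge \<open>uv\<close> is the pair of arcs \<open>(u, v)\<close>, \<open>(v, u)\<close>. The graph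
  without vertices is allowed.
\<close>

definition neighbors :: "'a pair_pre_digraph \<Rightarrow> 'a \<Rightarrow> 'a set" where
  "neighbors G v = {u. (v, u) \<in> parcs G}"

text \<open>
  \<open>H\<close> is a minor of \<open>G\<close> if there are pairwise disjoint branch sets \<open>B x\<close> (\<open>x\<close> a vertex of \<open>H\<close>),
  each inducing a connected subgraph of \<open>G\<close>, such that adjacent vertices of \<open>H\<close> have branch sets
  joined by an edge of \<open>G\<close>. Equivalently, \<open>H\<close> is obtained, up to isomorphism, from \<open>G\<close> by
  deleting vertices and edges and contracting edges. Branch sets are nonempty, since
  \<^const>\<open>connected\<close> excludes the graph without vertices.
\<close>

definition is_minor :: "'a pair_pre_digraph \<Rightarrow> 'b pair_pre_digraph \<Rightarrow> bool" where
  "is_minor H G \<longleftrightarrow>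
    (\<exists>B :: 'a \<Rightarrow> 'b set.
      (\<forall>x\<in>pverts H. B x \<subseteq> pverts G \<and> connected (with_proj G \<restriction> B x)) \<and>
      (\<forall>x\<in>pverts H. \<forall>y\<in>pverts H. x \<noteq> y \<longrightarrow> B x \<inter> B y = {}) \<and>
      (\<forall>(x, y)\<in>parcs H. \<exists>u\<in>B x. \<exists>v\<in>B y. (u, v) \<in> parcs G))"

text \<open>
  A graph class is represented by the set of its members with vertices in a type \<open>'a\<close>; if \<open>'a\<close>
  is infinite, this loses nothing up to isomorphism. Since isomorphic graphs are minors of each
  other, minor-closed classes are closed under isomorphism.
\<close>

definition minor_closed :: "'a pair_pre_digraph set \<Rightarrow> bool" where
  "minor_closed \<G> \<longleftrightarrow> (\<forall>G\<in>\<G>. \<forall>H. pair_graph H \<and> is_minor H G \<longrightarrow> H \<in> \<G>)"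

definition proper_class :: "'a pair_pre_digraph set \<Rightarrow> bool" where
  "proper_class \<G> \<longleftrightarrow> \<G> \<noteq> {G. pair_graph G}"

definition proper_coloring :: "'a pair_pre_digraph \<Rightarrow> nat \<Rightarrow> ('a \<Rightarrow> nat) \<Rightarrow> bool" where
  "proper_coloring G t \<phi> \<longleftrightarrow>
    \<phi> ` pverts G \<subseteq> {1..t} \<and> (\<forall>(u, v)\<in>parcs G. \<phi> u \<noteq> \<phi> v)"

definition strong_odd_coloring :: "'a pair_pre_digraph \<Rightarrow> nat \<Rightarrow> ('a \<Rightarrow> nat) \<Rightarrow> bool" where
  "strong_odd_coloring G t \<phi> \<longleftrightarrow>
    proper_coloring G t \<phi> \<and>
    (\<forall>v\<in>pverts G. \<forall>i\<in>{1..t}.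
      card {u \<in> neighbors G v. \<phi> u = i} = 0 \<or> odd (card {u \<in> neighbors G v. \<phi> u = i}))"

definition strong_odd_chromatic_number :: "'a pair_pre_digraph \<Rightarrow> nat" where
  "strong_odd_chromatic_number G = (LEAST t. \<exists>\<phi>. strong_odd_coloring G t \<phi>)"

text \<open>
  Coloring all vertices differently is strong odd, so the minimum is taken over a nonempty set.
\<close>

lemma ex_strong_odd_coloring:
  assumes "pair_graph G"
  shows "\<exists>\<phi>. strong_odd_coloring G (card (pverts G)) \<phi>"
proof -
  interpret pair_graph G by fact
  obtain \<phi> where \<phi>: "bij_betw \<phi> (pverts G) {1..card (pverts G)}"
    using ex_bij_betw_finite_nat[OF pair_finite_verts]
    by (metis card_atLeastAtMost diff_Suc_1 finite_atLeastAtMost finite_same_card_bij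
        pair_finite_verts)
  have inj: "\<phi> u \<noteq> \<phi> v" if "u \<in> pverts G" "v \<in> pverts G" "u \<noteq> v" for u v
    using \<phi> that by (meson bij_betw_def inj_onD)
  have "card {u \<in> neighbors G v. \<phi> u = i} = 0 \<or> card {u \<in> neighbors G v. \<phi> u = i} = 1" for v i
  proof (cases "{u \<in> neighbors G v. \<phi> u = i} = {}")
    case False
    then obtain u where u: "u \<in> neighbors G v" "\<phi> u = i" by blast
    then have "{u \<in> neighbors G v. \<phi> u = i} = {u}"
      using inj by (auto simp: neighbors_def dest: in_arcsD2)
    then show ?thesis by simp
  next
    case True
    then show ?thesis by (simp only: card.empty simp_thms)
  qed
  moreover have "proper_coloring G (card (pverts G)) \<phi>"
    using \<phi> inj[OF in_arcsD1 in_arcsD2 no_loops']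
    by (auto simp: proper_coloring_def bij_betw_def)
  ultimately show ?thesis
    unfolding strong_odd_coloring_def by (metis odd_one)
qed

end

theory Submission
  imports Defs
begin

text \<open>
  A proper minor-closed class excludes some \<open>K\<^sub>n\<close> as a minor, so by Mader's theorem all minors of its
  members are sparse. Peeling off vertices from the right gives a vertex order in which every
  vertex has boundedly many neighbours to its left, and every \<open>x\<close> has boundedly many \<open>y\<close> to its
  left that share with \<open>x\<close> a neighbour to the right of \<open>x\<close>. A greedy coloring \<open>\<gamma>\<close> along this order
  makes a left neighbour of \<open>v\<close> differ from every other neighbour of \<open>v\<close>, so only the right
  neighbours of \<open>v\<close> matter. Let the signature \<open>\<tau> u\<close> record \<open>\<gamma> u\<close> and, for any two left neighbours
  \<open>w < v\<close> of \<open>u\<close>, enough bounded information to recover \<open>w\<close> from \<open>v\<close>. Then for each signature \<open>s\<close>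
  the sets of right neighbours of \<open>v\<close> with signature \<open>s\<close> form, over all \<open>v\<close>, a laminar family of
  bounded depth, and such a family has a coloring with boundedly many colors in which each member
  sees each color zero or an odd number of times. The final color of \<open>u\<close> is \<open>\<tau> u\<close> together with its
  color in the family of \<open>\<tau> u\<close>.
\<close>

section \<open>Odd colorings of laminar families of bounded depth\<close>

text \<open>Induction on the depth: dropping the inclusion-maximal members lowers it by one, and a
  coloring of the rest is repaired on the maximal members by splitting colors in two, hence
  \<open>2 ^ k\<close>. The repairs do not interfere, as distinct maximal members are
  disjoint.\<close>

lemma laminar_odd_coloring:
  fixes F :: "'a set set"
  assumes "finite F" and "\<And>A. A \<in> F \<Longrightarrow> finite A"
    and "\<And>A B. A \<in> F \<Longrightarrow> B \<in> F \<Longrightarrow> A \<inter> B = {} \<or> A \<subseteq> B \<or> B \<subseteq> A"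
    and "\<And>x. card {A \<in> F. x \<in> A} \<le> k"
  shows "\<exists>\<chi> :: 'a \<Rightarrow> nat. (\<forall>x. \<chi> x < 2 ^ k) \<and>
    (\<forall>A\<in>F. \<forall>i. {x \<in> A. \<chi> x = i} = {} \<or> odd (card {x \<in> A. \<chi> x = i}))"
  using assms
proof (induction k arbitrary: F)
  case 0
  have "A = {}" if "A \<in> F" for A
  proof (rule ccontr)
    assume "A \<noteq> {}"
    then obtain x where "x \<in> A" by blast
    then have "A \<in> {A \<in> F. x \<in> A}" using that by simp
    moreover have "finite {A \<in> F. x \<in> A}" using 0(1) by simp
    ultimately have "card {A \<in> F. x \<in> A} > 0" by (auto simp: card_gt_0_iff)
    then show False using 0(4)[of x] by simp
  qed
  then show ?case by (intro exI[of _ "\<lambda>_. 0"]) auto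
next
  case (Suc k)
  define Mx where "Mx = {A \<in> F. \<forall>B\<in>F. A \<subseteq> B \<longrightarrow> B = A}"
  define F' where "F' = F - Mx"
  have depth: "card {A \<in> F'. x \<in> A} \<le> k" for x
  proof (cases "{A \<in> F'. x \<in> A} = {}")
    case False
    then obtain A where A: "A \<in> F" "x \<in> A" by (auto simp: F'_def)
    obtain M where M: "M \<in> F" "A \<subseteq> M" "\<forall>B\<in>F. M \<subseteq> B \<longrightarrow> B = M"
      using finite_has_maximal2[OF Suc.prems(1) A(1)] by auto
    have "M \<in> {A \<in> F. x \<in> A} - {A \<in> F'. x \<in> A}"
      using M A by (auto simp: F'_def Mx_def)
    then have "{A \<in> F'. x \<in> A} \<subset> {A \<in> F. x \<in> A}"
      by (auto simp: F'_def)
    then have "card {A \<in> F'. x \<in> A} < card {A \<in> F. x \<in> A}"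
      using Suc.prems(1) by (intro psubset_card_mono) auto
    then show ?thesis using Suc.prems(4)[of x] by simp
  qed (simp only: card.empty le0)
  have "\<exists>\<chi> :: 'a \<Rightarrow> nat. (\<forall>x. \<chi> x < 2 ^ k) \<and>
    (\<forall>A\<in>F'. \<forall>i. {x \<in> A. \<chi> x = i} = {} \<or> odd (card {x \<in> A. \<chi> x = i}))"
    using Suc.prems depth by (intro Suc.IH) (auto simp: F'_def)
  then obtain \<chi> :: "'a \<Rightarrow> nat" where "(\<forall>x. \<chi> x < 2 ^ k) \<and>
    (\<forall>A\<in>F'. \<forall>i. {x \<in> A. \<chi> x = i} = {} \<or> odd (card {x \<in> A. \<chi> x = i}))" ..
  then have \<chi>: "\<And>x. \<chi> x < 2 ^ k"
    "\<And>A i. A \<in> F' \<Longrightarrow> {x \<in> A. \<chi> x = i} = {} \<or> odd (card {x \<in> A. \<chi> x = i})"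
    by (simp, metis)
  txt \<open>
    A color \<open>i\<close> is bad for a maximal member \<open>M\<close> if \<open>\<chi>\<close> uses it a nonzero even number of times on \<open>M\<close>.
    Then a fresh copy of \<open>i\<close> replaces \<open>i\<close> on one maximal smaller member inside \<open>M\<close> (or on a single
    point in no smaller member) that sees \<open>i\<close> an odd number of times: it splits the even count into
    two odd ones. \<open>Q x\<close> is this part when it contains \<open>x\<close>, and \<open>Z\<close> is where the copies are used.
  \<close>
  define Q where "Q x = insert x (\<Union>{A \<in> F'. x \<in> A})" for x
  \<comment> \<open>By laminarity \<open>Q x\<close> cuts no smaller member, so replacing a color
    inside \<open>Q x\<close> leaves the color classes of members of \<open>F'\<close>
    whole.\<close>
  have Q_closed: "A \<subseteq> Q x" if A: "A \<in> F'" "A \<inter> Q x \<noteq> {}" for A x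
  proof -
    obtain z where z: "z \<in> A" "z \<in> Q x" using A by blast
    show ?thesis
    proof (cases "z = x")
      case True
      then show ?thesis using z that by (auto simp: Q_def)
    next
      case False
      then obtain B where B: "B \<in> F'" "x \<in> B" "z \<in> B" using z by (auto simp: Q_def)
      then have "A \<subseteq> B \<or> B \<subseteq> A" using Suc.prems(3)[of A B] that z by (auto simp: F'_def)
      then show ?thesis using B that by (auto simp: Q_def)
    qed
  qed
  \<comment> \<open>\<open>Q x\<close> is \<open>{x}\<close> or the largest member of
    \<open>F'\<close> containing \<open>x\<close>; there the color of \<open>x\<close> occurs, hence
    an odd number of times.\<close>
  have Q_odd: "odd (card {y \<in> Q x. \<chi> y = \<chi> x})" for x
  proof (cases "{A \<in> F'. x \<in> A} = {}")
    case True
    then have "{y \<in> Q x. \<chi> y = \<chi> x} = {x}" unfolding Q_def by auto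
    then show ?thesis by simp
  next
    case False
    have "finite {A \<in> F'. x \<in> A}" using Suc.prems(1) by (simp add: F'_def)
    from finite_has_maximal[OF this False] obtain B where B: "B \<in> F'" "x \<in> B"
      "\<forall>A\<in>{A \<in> F'. x \<in> A}. B \<subseteq> A \<longrightarrow> B = A" by blast
    have "A \<subseteq> B" if "A \<in> F'" "x \<in> A" for A
      using Suc.prems(3)[of A B] B that by (auto simp: F'_def)
    then have "Q x = B" using B by (auto simp: Q_def)
    then show ?thesis using \<chi>(2)[OF B(1), of "\<chi> x"] B(2) by auto
  qed
  have Q_sub: "Q x \<subseteq> M" if "M \<in> Mx" "x \<in> M" for x M
  proof -
    have "A \<subseteq> M" if "A \<in> F'" "x \<in> A" for A
      using Suc.prems(3)[of M A] that \<open>M \<in> Mx\<close> \<open>x \<in> M\<close> unfolding F'_def Mx_def by blast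
    then show ?thesis using that by (auto simp: Q_def)
  qed
  have Mx_disj: "M = M'" if "M \<in> Mx" "M' \<in> Mx" "z \<in> M" "z \<in> M'" for M M' z
    using Suc.prems(3)[of M M'] that unfolding Mx_def by blast
  define bad where "bad M i \<longleftrightarrow> {x \<in> M. \<chi> x = i} \<noteq> {} \<and> even (card {x \<in> M. \<chi> x = i})" for M i
  define p where "p M i = (SOME x. x \<in> M \<and> \<chi> x = i)" for M i
  have "p M i \<in> M \<and> \<chi> (p M i) = i" if "bad M i" for M i
    using that unfolding bad_def p_def by (intro someI_ex[of "\<lambda>x. x \<in> M \<and> \<chi> x = i"]) blast
  then have p: "\<And>M i. bad M i \<Longrightarrow> p M i \<in> M" "\<And>M i. bad M i \<Longrightarrow> \<chi> (p M i) = i"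
    by auto
  define Z where "Z = {x. \<exists>M\<in>Mx. bad M (\<chi> x) \<and> x \<in> Q (p M (\<chi> x))}"
  \<comment> \<open>Color \<open>i\<close> becomes \<open>2 * i\<close> and its fresh copy
    \<open>2 * i + 1\<close>, so \<open>j div 2\<close> and the parity of \<open>j\<close> recover
    both data.\<close>
  define \<psi> where "\<psi> x = 2 * \<chi> x + (if x \<in> Z then 1 else 0)" for x
  have \<psi>_eq: "\<psi> x = j \<longleftrightarrow> \<chi> x = j div 2 \<and> (x \<in> Z \<longleftrightarrow> odd j)" for x j
    unfolding \<psi>_def by (auto elim!: oddE)
  have "\<psi> x < 2 ^ Suc k" for x
    using \<chi>(1)[of x] by (simp add: \<psi>_def)
  moreover have "{x \<in> A. \<psi> x = j} = {} \<or> odd (card {x \<in> A. \<psi> x = j})" if "A \<in> F" for A j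
  proof (cases "A \<in> Mx")
    case False
    then have A: "A \<in> F'" using that by (simp add: F'_def)
    \<comment> \<open>\<open>Z\<close> contains all or none of the points of \<open>A\<close> of a
      given color, so on \<open>A\<close> the classes of \<open>\<chi>\<close> are merely
      renamed.\<close>
    have AZ: "y \<in> Z" if "x \<in> A" "y \<in> A" "\<chi> x = \<chi> y" "x \<in> Z" for x y
    proof -
      obtain M where M: "M \<in> Mx" "bad M (\<chi> x)" "x \<in> Q (p M (\<chi> x))"
        using \<open>x \<in> Z\<close> unfolding Z_def by blast
      then have "y \<in> Q (p M (\<chi> x))" using Q_closed[OF A, of "p M (\<chi> x)"] that by blast
      then show ?thesis using M that unfolding Z_def by auto
    qed
    show ?thesis
    proof (cases "{x \<in> A. \<psi> x = j} = {}")
      case False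
      then obtain x where x: "x \<in> A" "\<psi> x = j" by blast
      then have "y \<in> Z \<longleftrightarrow> x \<in> Z" if "y \<in> A" "\<chi> y = j div 2" for y
        using AZ[of x y] AZ[of y x] that unfolding \<psi>_eq by auto
      then have "{x \<in> A. \<psi> x = j} = {x \<in> A. \<chi> x = j div 2}"
        using x unfolding \<psi>_eq by auto
      then show ?thesis using \<chi>(2)[OF A, of "j div 2"] by simp
    qed simp
  next
    case True
    define i where "i = j div 2"
    have fin: "finite A" using Suc.prems(2) that by blast
    \<comment> \<open>Maximal members being disjoint, the points of \<open>Z\<close> in
      \<open>A\<close> stem from a bad color of \<open>A\<close> itself.\<close>
    have Zi: "bad A i \<and> x \<in> Q (p A i)" if x: "x \<in> A" "x \<in> Z" "\<chi> x = i" for x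
    proof -
      obtain M where M: "M \<in> Mx" "bad M i" "x \<in> Q (p M i)"
        using x unfolding Z_def by blast
      moreover have "x \<in> M" using Q_sub[OF M(1) p(1)[OF M(2)]] M(3) by blast
      ultimately show ?thesis using Mx_disj[OF True M(1) x(1)] by blast
    qed
    show ?thesis
    proof (cases "bad A i")
      case False
      then have "x \<notin> Z" if "x \<in> A" "\<chi> x = i" for x
        using Zi that by blast
      then have "{x \<in> A. \<psi> x = j} = (if odd j then {} else {x \<in> A. \<chi> x = i})"
        unfolding \<psi>_eq i_def[symmetric] by auto
      then show ?thesis using False unfolding bad_def by auto
    next
      case bad: True
      define Y where "Y = {x \<in> Q (p A i). \<chi> x = i}"
      have Y_odd: "odd (card Y)" using Q_odd[of "p A i"] p(2)[OF bad] by (simp add: Y_def)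
      have Y_sub: "Y \<subseteq> {x \<in> A. \<chi> x = i}"
        using Q_sub[OF True p(1)[OF bad]] by (auto simp: Y_def)
      have YZ: "x \<in> Z \<longleftrightarrow> x \<in> Y" if "x \<in> A" "\<chi> x = i" for x
        using Zi that bad True unfolding Z_def Y_def by auto
      have "{x \<in> A. \<psi> x = j} = (if odd j then Y else {x \<in> A. \<chi> x = i} - Y)"
        using YZ Y_sub unfolding \<psi>_eq i_def[symmetric] by auto
      moreover have "odd (card ({x \<in> A. \<chi> x = i} - Y))"
      proof -
        have "card ({x \<in> A. \<chi> x = i} - Y) = card {x \<in> A. \<chi> x = i} - card Y"
          using fin Y_sub by (intro card_Diff_subset) (auto intro: finite_subset)
        moreover have "card Y \<le> card {x \<in> A. \<chi> x = i}"
          using fin Y_sub by (intro card_mono) auto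
        ultimately show ?thesis using Y_odd bad unfolding bad_def by simp
      qed
      ultimately show ?thesis using Y_odd by simp
    qed
  qed
  ultimately show ?case by blast
qed

section \<open>Connected sets and clique minors of a relation\<close>

text \<open>Connectedness by cuts instead of paths, which makes gluing connected pieces a matter of
  finding one crossing edge.\<close>

definition linked :: "('a \<Rightarrow> 'a \<Rightarrow> bool) \<Rightarrow> 'a set \<Rightarrow> bool" where
  "linked E B \<longleftrightarrow> B \<noteq> {} \<and> (\<forall>X. X \<subseteq> B \<and> X \<noteq> {} \<and> X \<noteq> B \<longrightarrow> (\<exists>x\<in>X. \<exists>y\<in>B - X. E x y))"

text \<open>Branch sets of a complete minor on \<open>n\<close> vertices. The edge relation is
  separate from the vertex set, so a contracted graph can live on a subset of the old vertices with
  a new relation.\<close>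

definition clique_model :: "('a \<Rightarrow> 'a \<Rightarrow> bool) \<Rightarrow> 'a set \<Rightarrow> nat \<Rightarrow> (nat \<Rightarrow> 'a set) \<Rightarrow> bool" where
  "clique_model E V n B \<longleftrightarrow> (\<forall>i<n. B i \<subseteq> V \<and> linked E (B i)) \<and>
    (\<forall>i<n. \<forall>j<n. i \<noteq> j \<longrightarrow> B i \<inter> B j = {} \<and> (\<exists>u\<in>B i. \<exists>v\<in>B j. E u v))"

definition clique_minor :: "('a \<Rightarrow> 'a \<Rightarrow> bool) \<Rightarrow> 'a set \<Rightarrow> nat \<Rightarrow> bool" where
  "clique_minor E V n \<longleftrightarrow> (\<exists>B. clique_model E V n B)"

lemma clique_modelD:
  assumes "clique_model E V n B"
  shows "i < n \<Longrightarrow> B i \<subseteq> V \<and> linked E (B i)"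
    and "i < n \<Longrightarrow> j < n \<Longrightarrow> i \<noteq> j \<Longrightarrow> B i \<inter> B j = {} \<and> (\<exists>u\<in>B i. \<exists>v\<in>B j. E u v)"
  using assms unfolding clique_model_def by auto

text \<open>Ordered pairs: for symmetric \<open>E\<close> every edge counts twice.\<close>

definition arcs_in :: "('a \<Rightarrow> 'a \<Rightarrow> bool) \<Rightarrow> 'a set \<Rightarrow> ('a \<times> 'a) set" where
  "arcs_in E V = {(u, v). u \<in> V \<and> v \<in> V \<and> E u v}"

lemma linked_singleton: "linked E {x}"
  unfolding linked_def by blast

text \<open>Serves for branch sets that arise by contracting neighbours of \<open>x\<close> into
  \<open>x\<close>.\<close>

lemma linked_star:
  assumes "\<And>u. u \<in> U \<Longrightarrow> E u x \<and> E x u"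
  shows "linked E (insert x U)"
  unfolding linked_def
proof (intro conjI allI impI)
  fix X assume X: "X \<subseteq> insert x U \<and> X \<noteq> {} \<and> X \<noteq> insert x U"
  then obtain a b where "a \<in> X" "b \<in> insert x U - X" by blast
  then show "\<exists>a\<in>X. \<exists>b\<in>insert x U - X. E a b"
    using assms X by (cases "x \<in> X") blast+
qed blast

text \<open>If \<open>X\<close> cuts some piece \<open>A s\<close>, that piece supplies the crossing
  edge. Otherwise \<open>X\<close> is a union of whole pieces, and the cut is transferred to the
  index set \<open>B\<close>.\<close>

lemma linked_UN:
  assumes "linked E' B" and "\<And>s. s \<in> B \<Longrightarrow> linked E (A s)"
    and "\<And>s t. s \<in> B \<Longrightarrow> t \<in> B \<Longrightarrow> E' s t \<Longrightarrow> \<exists>u\<in>A s. \<exists>v\<in>A t. E u v"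
  shows "linked E (\<Union>s\<in>B. A s)"
  unfolding linked_def
proof (intro conjI allI impI)
  have ne: "A s \<noteq> {}" if "s \<in> B" for s using assms(2)[OF that] by (simp add: linked_def)
  moreover have "B \<noteq> {}" using assms(1) by (simp add: linked_def)
  ultimately show "(\<Union>s\<in>B. A s) \<noteq> {}" by blast
  fix X assume X: "X \<subseteq> (\<Union>s\<in>B. A s) \<and> X \<noteq> {} \<and> X \<noteq> (\<Union>s\<in>B. A s)"
  show "\<exists>x\<in>X. \<exists>y\<in>(\<Union>s\<in>B. A s) - X. E x y"
  proof (cases "\<exists>s\<in>B. A s \<inter> X \<noteq> {} \<and> \<not> A s \<subseteq> X")
    case True
    then obtain s where s: "s \<in> B" "A s \<inter> X \<noteq> {}" "\<not> A s \<subseteq> X" by blast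
    have "\<exists>x\<in>A s \<inter> X. \<exists>y\<in>A s - (A s \<inter> X). E x y"
      using assms(2)[OF s(1)] s(2,3) unfolding linked_def by blast
    then show ?thesis using s(1) by blast
  next
    case False
    define T where "T = {s \<in> B. A s \<subseteq> X}"
    have T: "T \<subseteq> B \<and> T \<noteq> {} \<and> T \<noteq> B"
    proof (intro conjI)
      show "T \<noteq> {}" using X False unfolding T_def by blast
      show "T \<noteq> B" using X unfolding T_def by blast
    qed (simp add: T_def)
    have "\<exists>s\<in>T. \<exists>t\<in>B - T. E' s t"
      using assms(1) T unfolding linked_def by presburger
    then obtain s t where st: "s \<in> T" "t \<in> B - T" "E' s t" by blast
    then have "\<exists>u\<in>A s. \<exists>v\<in>A t. E u v"
      using T by (intro assms(3)) blast+
    then obtain u v where "u \<in> A s" "v \<in> A t" "E u v" by blast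
    moreover have "A t \<inter> X = {}" using False st unfolding T_def by blast
    ultimately show ?thesis using st unfolding T_def by blast
  qed
qed

text \<open>A minor of a minor is a minor: the branch sets in \<open>S\<close> are blown up by
  \<open>A\<close>. This lifts clique minors from contracted graphs.\<close>

lemma clique_minor_trans:
  assumes "clique_minor E' S n"
    and A: "\<And>s. s \<in> S \<Longrightarrow> A s \<subseteq> V \<and> linked E (A s)"
    and disj: "\<And>s t. s \<in> S \<Longrightarrow> t \<in> S \<Longrightarrow> s \<noteq> t \<Longrightarrow> A s \<inter> A t = {}"
    and edge: "\<And>s t. s \<in> S \<Longrightarrow> t \<in> S \<Longrightarrow> E' s t \<Longrightarrow> \<exists>u\<in>A s. \<exists>v\<in>A t. E u v"
  shows "clique_minor E V n"
proof -
  obtain B where "clique_model E' S n B"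
    using assms(1) unfolding clique_minor_def ..
  note B = clique_modelD[OF this]
  show ?thesis unfolding clique_minor_def clique_model_def
  proof (intro exI[of _ "\<lambda>i. \<Union>s\<in>B i. A s"] conjI allI impI)
    fix i assume i: "i < n"
    show "(\<Union>s\<in>B i. A s) \<subseteq> V" using B(1)[OF i] A by blast
    show "linked E (\<Union>s\<in>B i. A s)"
      using B(1)[OF i] A edge by (intro linked_UN[of E']) blast+
  next
    fix i j assume ij: "i < n" "j < n" "i \<noteq> j"
    have "A s \<inter> A t = {}" if "s \<in> B i" "t \<in> B j" for s t
      using disj[of s t] B(1)[OF ij(1)] B(1)[OF ij(2)] B(2)[OF ij] that by blast
    then show "(\<Union>s\<in>B i. A s) \<inter> (\<Union>s\<in>B j. A s) = {}" by blast
    obtain s t where "s \<in> B i" "t \<in> B j" "E' s t" using B(2)[OF ij] by blast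
    moreover from this have "\<exists>u\<in>A s. \<exists>v\<in>A t. E u v"
      using edge[of s t] B(1)[OF ij(1)] B(1)[OF ij(2)] by blast
    ultimately show "\<exists>u\<in>\<Union>s\<in>B i. A s. \<exists>v\<in>\<Union>s\<in>B j. A s. E u v" by blast
  qed
qed

section \<open>Mader's theorem on dense graphs\<close>

text \<open>In closed form \<open>2 ^ (n + 1) - 2\<close>. Doubling pays for the arcs lost in a
  contraction, and the summand 2 keeps the bound positive for \<open>n > 0\<close>.\<close>

fun mader_bound :: "nat \<Rightarrow> nat" where
  "mader_bound 0 = 0"
| "mader_bound (Suc n) = 2 * mader_bound n + 2"

lemma card_arcs_in:
  assumes "finite V"
  shows "card (arcs_in E V) = (\<Sum>x\<in>V. card {y \<in> V. E x y})"
proof -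
  have "arcs_in E V = (SIGMA x:V. {y \<in> V. E x y})" by (auto simp: arcs_in_def)
  then show ?thesis using assms by simp
qed

lemma finite_arcs_in: "finite V \<Longrightarrow> finite (arcs_in E V)"
  unfolding arcs_in_def by (rule finite_subset[of _ "V \<times> V"]) auto

text \<open>Every branch set inside the neighbourhood of \<open>x\<close> is joined to
  \<open>x\<close>, so \<open>{x}\<close> is one more branch set.\<close>

lemma clique_minor_Suc:
  assumes "clique_minor E {y \<in> V. E x y} n" and "x \<in> V" and "\<not> E x x"
    and "\<And>x y. E x y \<Longrightarrow> E y x"
  shows "clique_minor E V (Suc n)"
proof -
  obtain B where "clique_model E {y \<in> V. E x y} n B"
    using assms(1) unfolding clique_minor_def ..
  note B = clique_modelD[OF this]
  have x: "x \<notin> B i \<and> (\<exists>u\<in>B i. E u x \<and> E x u)" if "i < n" for i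
  proof -
    have "B i \<noteq> {}" using B(1)[OF that] by (simp add: linked_def)
    then obtain u where "u \<in> B i" by blast
    then show ?thesis using B(1)[OF that] assms(3,4) by blast
  qed
  show ?thesis unfolding clique_minor_def clique_model_def
  proof (intro exI[of _ "B(n := {x})"] conjI allI impI)
    fix i assume "i < Suc n"
    then show "(B(n := {x})) i \<subseteq> V" "linked E ((B(n := {x})) i)"
      using B(1)[of i] assms(2) linked_singleton[of E x] by (auto simp: less_Suc_eq)
  next
    fix i j assume "i < Suc n" "j < Suc n" "i \<noteq> j"
    then show "(B(n := {x})) i \<inter> (B(n := {x})) j = {}"
      "\<exists>u\<in>(B(n := {x})) i. \<exists>v\<in>(B(n := {x})) j. E u v"
      using B(2)[of i j] x[of i] x[of j] by (auto simp: less_Suc_eq)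
  qed
qed

text \<open>Induction on \<open>n\<close>, then on the number of vertices. Either the neighbourhood
  of some \<open>x\<close> is dense enough for the case \<open>n\<close> and \<open>x\<close> is
  added to the model, or some edge at \<open>x\<close> has few common neighbours and contracting it
  preserves the density.\<close>

lemma mader:
  assumes "finite V" and "V \<noteq> {}" and "\<And>x y. E x y \<Longrightarrow> E y x" and "\<And>x. \<not> E x x"
    and "card (arcs_in E V) \<ge> mader_bound n * card V"
  shows "clique_minor E V n"
  using assms
proof (induction n arbitrary: V E)
  case 0
  then show ?case by (simp add: clique_minor_def clique_model_def)
next
  case (Suc n)
  note IHn = Suc.IH
  from Suc.prems show ?case
  proof (induction "card V" arbitrary: V E rule: less_induct)
    case less
    note fin = \<open>finite V\<close> and sym = less.prems(3) and irr = less.prems(4)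
    let ?D = "mader_bound n"
    \<comment> \<open>The bound is positive and \<open>V\<close> nonempty, so there is an edge, and
      the neighbourhood of \<open>x\<close> is not empty.\<close>
    have "card (arcs_in E V) > 0"
      using less.prems(1,2,5) by (auto intro!: Nat.gr0I simp: card_eq_0_iff)
    then obtain x y0 where xy0: "x \<in> V" "y0 \<in> V" "E x y0"
      by (fastforce simp: card_gt_0_iff arcs_in_def)
    let ?N = "{y \<in> V. E x y}"
    show ?case
    proof (cases "\<forall>y\<in>?N. card {z \<in> ?N. E y z} \<ge> ?D")
      case True
      have "card (arcs_in E ?N) \<ge> ?D * card ?N"
        using sum_mono[of ?N "\<lambda>_. ?D" "\<lambda>y. card {z \<in> ?N. E y z}"] True fin
        by (simp add: card_arcs_in mult.commute)
      then have "clique_minor E ?N n"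
        using xy0 fin sym irr by (intro IHn) auto
      then show ?thesis using clique_minor_Suc[of E V x n] xy0(1) sym irr by blast
    next
      case False
      then obtain y where y: "y \<in> V" "E x y" and few: "card {z \<in> ?N. E y z} < ?D" by auto
      have xy: "x \<noteq> y" using y irr by blast
      txt \<open>
        Contracting \<open>xy\<close> loses at most \<open>mader_bound (Suc n)\<close> arcs, as \<open>x\<close> and \<open>y\<close> have few common
        neighbours.
      \<close>
      define E' where
        "E' s t \<longleftrightarrow> s \<noteq> t \<and> (E s t \<or> s = x \<and> E y t \<or> t = x \<and> E s y)" for s t
      define W where "W = V - {y}"
      define A where "A s = (if s = x then {x, y} else {s})" for s
      \<comment> \<open>\<open>P\<close> consists of the neighbours that \<open>x\<close> inherits
        from \<open>y\<close>. The arcs lost are those between \<open>x\<close> and \<open>y\<close>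
        and those from \<open>y\<close> to common neighbours, each in both directions.\<close>
      define P where "P = {z \<in> V. E y z \<and> \<not> E x z \<and> z \<noteq> x}"
      define A0 where "A0 = arcs_in E W"
      have cardW: "card V = Suc (card W)"
        using fin y unfolding W_def by (metis card.remove)
      have "{z \<in> V. E y z} = insert x ({z \<in> ?N. E y z} \<union> P)"
        using sym[OF y(2)] xy0 unfolding P_def by blast
      then have deg: "card {z \<in> V. E y z} \<le> card {z \<in> ?N. E y z} + card P + 1"
        using card_insert_le_m1 card_Un_le[of "{z \<in> ?N. E y z}" P] fin
        by (simp add: card_insert_if P_def)
      have "arcs_in E V = A0 \<union> {y} \<times> {z \<in> V. E y z} \<union> {z \<in> V. E y z} \<times> {y}"
        using y(1) sym irr unfolding A0_def W_def arcs_in_def by blast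
      then have "card (arcs_in E V) \<le> card A0 + card ({y} \<times> {z \<in> V. E y z}) + card ({z \<in> V. E y z} \<times> {y})"
        using card_Un_le order_trans[OF card_Un_le add_right_mono[OF card_Un_le]] by metis
      then have up: "card (arcs_in E V) \<le> card A0 + 2 * card {z \<in> V. E y z}"
        by (simp add: card_cartesian_product)
      have finP: "finite P" and finA0: "finite A0"
        using fin by (auto simp: P_def A0_def W_def intro!: finite_arcs_in)
      have "A0 \<union> ({x} \<times> P \<union> P \<times> {x}) \<subseteq> arcs_in E' W"
        using xy0 xy irr sym unfolding A0_def P_def W_def arcs_in_def E'_def by auto
      then have "card (A0 \<union> ({x} \<times> P \<union> P \<times> {x})) \<le> card (arcs_in E' W)"
        using fin by (intro card_mono finite_arcs_in) (auto simp: W_def)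
      moreover have "card (A0 \<union> ({x} \<times> P \<union> P \<times> {x})) = card A0 + (card P + card P)"
      proof -
        have "card (A0 \<union> ({x} \<times> P \<union> P \<times> {x})) = card A0 + card ({x} \<times> P \<union> P \<times> {x})"
          using finP finA0 sym by (intro card_Un_disjoint) (auto simp: A0_def arcs_in_def P_def)
        also have "card ({x} \<times> P \<union> P \<times> {x}) = card ({x} \<times> P) + card (P \<times> {x})"
          using finP by (intro card_Un_disjoint) (auto simp: P_def)
        finally show ?thesis by (simp add: card_cartesian_product)
      qed
      ultimately have low: "card A0 + 2 * card P \<le> card (arcs_in E' W)" by simp
      have "card (arcs_in E V) \<le> card (arcs_in E' W) + mader_bound (Suc n)"
        using low up deg few by simp
      then have "card (arcs_in E' W) \<ge> mader_bound (Suc n) * card W"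
        using less.prems(5) cardW by simp
      moreover have "x \<in> W" using xy0 xy by (simp add: W_def)
      ultimately have "clique_minor E' W (Suc n)"
      proof (intro less.hyps)
        fix s t assume "E' s t" then show "E' t s" using sym unfolding E'_def by blast
      qed (use cardW fin in \<open>auto simp: W_def E'_def\<close>)
      then show ?thesis
      proof (rule clique_minor_trans[where A = A])
        fix s assume "s \<in> W"
        then show "A s \<subseteq> V \<and> linked E (A s)"
          using linked_star[of "{y}" E x] linked_singleton[of E s] y xy0 sym[OF y(2)]
          by (auto simp: A_def W_def insert_commute)
      next
        fix s t assume "s \<in> W" "t \<in> W" "s \<noteq> t"
        then show "A s \<inter> A t = {}" by (auto simp: A_def W_def)
      next
        fix s t assume "E' s t"
        then show "\<exists>u\<in>A s. \<exists>v\<in>A t. E u v" by (auto simp: A_def E'_def split: if_splits)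
      qed
    qed
  qed
qed

section \<open>Sparse vertex orders in graphs without a large clique minor\<close>

text \<open>Markov's inequality. Fewer than half are exceptional, so two such conditions can be met
  at once.\<close>

lemma card_exceeding_lt_half:
  fixes f :: "'a \<Rightarrow> nat"
  assumes "finite S" and "sum f S < K * card S"
  shows "2 * card {x \<in> S. f x > 2 * K} < card S"
proof -
  let ?B = "{x \<in> S. f x > 2 * K}"
  have "2 * K * card ?B \<le> sum f ?B"
    using sum_mono[of ?B "\<lambda>_. 2 * K" f] by (simp add: mult.commute)
  also have "\<dots> \<le> sum f S" using assms(1) by (intro sum_mono2) auto
  finally have "2 * K * card ?B < K * card S" using assms(2) by linarith
  moreover have "2 * K * card ?B = K * (2 * card ?B)" by simp
  ultimately have "K * (2 * card ?B) < K * card S" by metis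
  then show ?thesis by simp
qed

lemma clique_minor_mono:
  assumes "clique_minor E S n" and "S \<subseteq> V"
  shows "clique_minor E V n"
  using assms(1)
  by (rule clique_minor_trans[where A = "\<lambda>s. {s}"]) (use assms(2) linked_singleton in auto)

definition sparse_order_bound :: "nat \<Rightarrow> nat" where
  "sparse_order_bound n = 2 * mader_bound n"

text \<open>\<open>Suc (sparse_order_bound n)\<close> many minors contribute arcs, each at an
  average below \<open>mader_bound n\<close>; the outer 2 comes from Markov's inequality.\<close>

definition reach_bound :: "nat \<Rightarrow> nat" where
  "reach_bound n = 2 * (Suc (sparse_order_bound n) * mader_bound n)"

text \<open>\<open>S\<close> is the part still to be ordered, and the vertices outside it lie to its
  right. Both \<open>E\<close> and the relation of having a common neighbour outside
  \<open>S\<close> have few arcs on \<open>S\<close>, so some vertex has small degree in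
  both.\<close>

lemma exists_peelable_vertex:
  assumes fin: "finite V" and S: "S \<subseteq> V" "S \<noteq> {}"
    and sym: "\<And>x y. E x y \<Longrightarrow> E y x" and irr: "\<And>x. \<not> E x x"
    and no: "\<not> clique_minor E V n"
    and few: "\<And>u. u \<in> V - S \<Longrightarrow> card {y \<in> S. E u y} \<le> sparse_order_bound n"
  shows "\<exists>x\<in>S. card {y \<in> S. E x y} \<le> sparse_order_bound n \<and>
    card {y \<in> S. y \<noteq> x \<and> (\<exists>u\<in>V - S. E u x \<and> E u y)} \<le> reach_bound n"
proof -
  define D where "D = mader_bound n"
  define c where "c = sparse_order_bound n"
  have finS: "finite S" using fin S finite_subset by blast
  have a1: "card (arcs_in E S) < D * card S"
    using mader[where E = E, OF finS S(2) sym irr, where n = n] clique_minor_mono[OF _ S(1)] no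
    unfolding D_def by (meson not_le)
  \<comment> \<open>\<open>g u\<close> lists the neighbours of \<open>u\<close> in \<open>S\<close>.
    Surplus indices have arbitrary values, which is why \<open>A\<close> below also demands
    \<open>E u s\<close>.\<close>
  have "\<exists>g. {y \<in> S. E u y} \<subseteq> g ` {..c}" if "u \<in> V - S" for u
  proof -
    let ?N = "{y \<in> S. E u y}"
    obtain h where "bij_betw h {0..<card ?N} ?N"
      using ex_bij_betw_nat_finite[of ?N] finS by auto
    then have "?N = h ` {0..<card ?N}" by (simp add: bij_betw_def)
    also have "\<dots> \<subseteq> h ` {..c}" using few[OF that] by (intro image_mono) (auto simp: c_def)
    finally show ?thesis by (rule exI[of _ h])
  qed
  then have "\<exists>g. \<forall>u\<in>V - S. {y \<in> S. E u y} \<subseteq> g u ` {..c}"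
    by (intro bchoice ballI)
  then obtain g where g: "\<forall>u\<in>V - S. {y \<in> S. E u y} \<subseteq> g u ` {..c}" ..
  txt \<open>
    Contracting every \<open>u\<close> outside \<open>S\<close> into its \<open>i\<close>-th neighbour in \<open>S\<close> gives a minor \<open>E' i\<close> on \<open>S\<close>;
    the \<open>c + 1\<close> minors together join all pairs of \<open>S\<close> with a common neighbour outside \<open>S\<close>.
  \<close>
  define A where "A i s = insert s {u \<in> V - S. E u s \<and> g u i = s}" for i s
  define E' where "E' i s t \<longleftrightarrow> s \<noteq> t \<and> (\<exists>a\<in>A i s. \<exists>b\<in>A i t. E a b)" for i s t
  have E'_sym: "E' i s t \<Longrightarrow> E' i t s" for i s t
    using sym unfolding E'_def by blast
  have a2: "card (arcs_in (E' i) S) < D * card S" for i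
  proof (rule ccontr)
    assume "\<not> card (arcs_in (E' i) S) < D * card S"
    then have "clique_minor (E' i) S n"
      by (intro mader[where E = "E' i", OF finS S(2) E'_sym]) (auto simp: E'_def D_def)
    then have "clique_minor E V n"
    proof (rule clique_minor_trans[where A = "A i"])
      fix s assume s: "s \<in> S"
      have "linked E (A i s)" unfolding A_def using sym by (intro linked_star) auto
      then show "A i s \<subseteq> V \<and> linked E (A i s)" using s S(1) by (auto simp: A_def)
    qed (auto simp: A_def E'_def)
    then show False using no by simp
  qed
  define H where "H s t \<longleftrightarrow> t \<noteq> s \<and> (\<exists>u\<in>V - S. E u s \<and> E u t)" for s t
  have "arcs_in H S \<subseteq> (\<Union>i\<le>c. arcs_in (E' i) S)"
  proof
    fix p assume "p \<in> arcs_in H S"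
    then obtain s t u where p: "p = (s, t)" "s \<in> S" "t \<in> S" "t \<noteq> s" "u \<in> V - S" "E u s" "E u t"
      unfolding arcs_in_def H_def by blast
    \<comment> \<open>At index \<open>i\<close> the vertex \<open>u\<close> is contracted into
      \<open>s\<close>, and its edge to \<open>t\<close> joins the two branch sets.\<close>
    then obtain i where i: "i \<le> c" "g u i = s"
      using g by (metis (no_types, lifting) atMost_iff imageE mem_Collect_eq subset_iff)
    then have "u \<in> A i s" "t \<in> A i t" using p by (auto simp: A_def)
    then have "E' i s t" using p unfolding E'_def by blast
    then show "p \<in> (\<Union>i\<le>c. arcs_in (E' i) S)" using p i by (auto simp: arcs_in_def)
  qed
  then have "card (arcs_in H S) \<le> card (\<Union>i\<le>c. arcs_in (E' i) S)"
    using finS by (intro card_mono) (auto intro: finite_arcs_in)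
  also have "\<dots> \<le> (\<Sum>i\<le>c. card (arcs_in (E' i) S))" by (rule card_UN_le) simp
  also have "\<dots> < (\<Sum>i\<le>c. D * card S)" using a2 by (intro sum_strict_mono) auto
  finally have a3: "card (arcs_in H S) < Suc c * D * card S" by (simp add: algebra_simps)
  let ?B1 = "{x \<in> S. card {y \<in> S. E x y} > 2 * D}"
  let ?B2 = "{x \<in> S. card {y \<in> S. H x y} > 2 * (Suc c * D)}"
  have "2 * card ?B1 < card S"
    using a1 finS by (intro card_exceeding_lt_half) (auto simp: card_arcs_in)
  moreover have "2 * card ?B2 < card S"
    using a3 finS by (intro card_exceeding_lt_half) (auto simp: card_arcs_in)
  ultimately have "card (?B1 \<union> ?B2) < card S" using card_Un_le[of ?B1 ?B2] by linarith
  then have "?B1 \<union> ?B2 \<noteq> S" by auto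
  then obtain x where "x \<in> S" "x \<notin> ?B1" "x \<notin> ?B2" by blast
  then show ?thesis
    by (intro bexI[of _ x])
      (auto simp: H_def D_def c_def sparse_order_bound_def reach_bound_def not_less)
qed

text \<open>Vertices outside \<open>S\<close> count as lying to the right of all of
  \<open>S\<close>. The induction peels off a vertex \<open>x0\<close> and ranks it last; its small
  degree into \<open>S\<close> preserves the degree bound for vertices outside the remaining
  set.\<close>

lemma exists_partial_sparse_order:
  assumes fin: "finite V" and sym: "\<And>x y. E x y \<Longrightarrow> E y x" and irr: "\<And>x. \<not> E x x"
    and no: "\<not> clique_minor E V n" and "S \<subseteq> V"
    and "\<And>u. u \<in> V - S \<Longrightarrow> card {y \<in> S. E u y} \<le> sparse_order_bound n"
  shows "\<exists>r :: 'a \<Rightarrow> nat. inj_on r S \<and> (\<forall>x\<in>S. r x < card S) \<and>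
    (\<forall>x\<in>S. card {y \<in> S. r y < r x \<and> E x y} \<le> sparse_order_bound n \<and>
      card {y \<in> S. r y < r x \<and> (\<exists>u\<in>V. (u \<in> S \<longrightarrow> r x < r u) \<and> E u x \<and> E u y)} \<le> reach_bound n)"
  using assms(5,6)
proof (induction "card S" arbitrary: S)
  case 0
  then have "S = {}" using fin finite_subset by fastforce
  then show ?case by simp
next
  case (Suc k)
  have finS: "finite S" using fin Suc.prems finite_subset by blast
  have "S \<noteq> {}" using Suc.hyps by auto
  then obtain x0 where x0: "x0 \<in> S" "card {y \<in> S. E x0 y} \<le> sparse_order_bound n"
    "card {y \<in> S. y \<noteq> x0 \<and> (\<exists>u\<in>V - S. E u x0 \<and> E u y)} \<le> reach_bound n"
    using exists_peelable_vertex[where E = E, OF fin Suc.prems(1) _ sym irr no Suc.prems(2)] by blast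
  define T where "T = S - {x0}"
  have k: "card T = k" using Suc.hyps x0(1) finS by (simp add: T_def)
  have "card {y \<in> T. E u y} \<le> sparse_order_bound n" if "u \<in> V - T" for u
  proof -
    have "card {y \<in> T. E u y} \<le> card {y \<in> S. E u y}"
      using finS by (intro card_mono) (auto simp: T_def)
    also have "\<dots> \<le> sparse_order_bound n"
      using that x0(2) Suc.prems(2)[of u] by (cases "u = x0") (auto simp: T_def)
    finally show ?thesis .
  qed
  then have "\<exists>r :: 'a \<Rightarrow> nat. inj_on r T \<and> (\<forall>x\<in>T. r x < card T) \<and>
    (\<forall>x\<in>T. card {y \<in> T. r y < r x \<and> E x y} \<le> sparse_order_bound n \<and>
      card {y \<in> T. r y < r x \<and> (\<exists>u\<in>V. (u \<in> T \<longrightarrow> r x < r u) \<and> E u x \<and> E u y)} \<le> reach_bound n)"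
    using k Suc.prems(1) by (intro Suc.hyps(1)) (auto simp: T_def)
  then obtain r :: "'a \<Rightarrow> nat" where r: "inj_on r T" "\<forall>x\<in>T. r x < k"
    "\<forall>x\<in>T. card {y \<in> T. r y < r x \<and> E x y} \<le> sparse_order_bound n \<and>
      card {y \<in> T. r y < r x \<and> (\<exists>u\<in>V. (u \<in> T \<longrightarrow> r x < r u) \<and> E u x \<and> E u y)} \<le> reach_bound n"
    unfolding k by (elim exE conjE)
  define q where "q = r(x0 := k)"
  have qT: "q x = r x" "q x < k" if "x \<in> T" for x using that r(2) by (auto simp: q_def T_def)
  have q0: "q x0 = k" by (simp add: q_def)
  have ST: "S = insert x0 T" "x0 \<notin> T" using x0(1) by (auto simp: T_def)
  have "inj_on q S"
    using r(1) qT q0 unfolding ST(1) inj_on_insert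
    by (auto simp: inj_on_def) (metis less_irrefl)+
  moreover have "\<forall>x\<in>S. q x < card S" using qT q0 Suc.hyps(2) unfolding ST(1) by fastforce
  moreover have "card {y \<in> S. q y < q x \<and> E x y} \<le> sparse_order_bound n \<and>
      card {y \<in> S. q y < q x \<and> (\<exists>u\<in>V. (u \<in> S \<longrightarrow> q x < q u) \<and> E u x \<and> E u y)} \<le> reach_bound n"
    if x: "x \<in> S" for x
  proof (cases "x = x0")
    case True
    \<comment> \<open>No vertex of \<open>S\<close> ranks above \<open>x0\<close>, so only vertices
      outside \<open>S\<close> lie to its right.\<close>
    have below: "q y \<le> k" if "y \<in> S" for y using that qT(2)[of y] q0 unfolding ST(1) by auto
    have "card {y \<in> S. q y < q x \<and> E x y} \<le> card {y \<in> S. E x0 y}"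
      using finS True by (intro card_mono) auto
    moreover have "card {y \<in> S. q y < q x \<and> (\<exists>u\<in>V. (u \<in> S \<longrightarrow> q x < q u) \<and> E u x \<and> E u y)}
      \<le> card {y \<in> S. y \<noteq> x0 \<and> (\<exists>u\<in>V - S. E u x0 \<and> E u y)}"
      using finS True q0 below by (intro card_mono) (auto simp: not_less[symmetric])
    ultimately show ?thesis using x0 by linarith
  next
    case False
    then have xT: "x \<in> T" using x by (simp add: T_def)
    have lt: "y \<in> S \<and> q y < q x \<longleftrightarrow> y \<in> T \<and> r y < r x" for y
      using qT[OF xT] qT[of y] q0 unfolding ST(1) by auto
    \<comment> \<open>\<open>x0\<close> lies to the right of \<open>x\<close> in both readings: as a
      vertex outside \<open>T\<close> and as the vertex of rank \<open>k\<close>.\<close>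
    have gt: "(u \<in> S \<longrightarrow> q x < q u) \<longleftrightarrow> (u \<in> T \<longrightarrow> r x < r u)" for u
      using qT[OF xT] qT[of u] q0 unfolding ST(1) by auto
    have "{y \<in> S. q y < q x \<and> E x y} = {y \<in> T. r y < r x \<and> E x y}"
      using lt by blast
    moreover have "{y \<in> S. q y < q x \<and> (\<exists>u\<in>V. (u \<in> S \<longrightarrow> q x < q u) \<and> E u x \<and> E u y)} =
      {y \<in> T. r y < r x \<and> (\<exists>u\<in>V. (u \<in> T \<longrightarrow> r x < r u) \<and> E u x \<and> E u y)}"
      unfolding gt using lt by blast
    ultimately show ?thesis using r(3) xT by simp
  qed
  ultimately show ?case by blast
qed

lemma exists_sparse_order:
  assumes "finite V" and "\<And>x y. E x y \<Longrightarrow> E y x" and "\<And>x. \<not> E x x"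
    and "\<not> clique_minor E V n"
  shows "\<exists>r :: 'a \<Rightarrow> nat. inj_on r V \<and>
    (\<forall>x\<in>V. card {y \<in> V. r y < r x \<and> E x y} \<le> sparse_order_bound n \<and>
      card {y \<in> V. r y < r x \<and> (\<exists>u\<in>V. r x < r u \<and> E u x \<and> E u y)} \<le> reach_bound n)"
proof -
  have "\<exists>r :: 'a \<Rightarrow> nat. inj_on r V \<and> (\<forall>x\<in>V. r x < card V) \<and>
    (\<forall>x\<in>V. card {y \<in> V. r y < r x \<and> E x y} \<le> sparse_order_bound n \<and>
      card {y \<in> V. r y < r x \<and> (\<exists>u\<in>V. (u \<in> V \<longrightarrow> r x < r u) \<and> E u x \<and> E u y)} \<le> reach_bound n)"
    by (rule exists_partial_sparse_order[where E = E, OF assms]) auto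
  then show ?thesis by (elim exE conjE, intro exI conjI) (simp_all cong: bex_cong)
qed

section \<open>Strong odd colorings from sparse orders\<close>

text \<open>Vertices are colored by increasing rank; at most \<open>m\<close> of the
  \<open>m + 1\<close> colors are forbidden. As \<open>r\<close> is injective, each step recolors at
  most one vertex, and vertices of smaller rank do not look at it.\<close>

lemma greedy_coloring:
  fixes r :: "'a \<Rightarrow> nat"
  assumes fin: "finite V" and inj: "inj_on r V"
    and C: "\<And>x. x \<in> V \<Longrightarrow> card {y \<in> V. r y < r x \<and> C x y} \<le> m"
  shows "\<exists>\<gamma> :: 'a \<Rightarrow> nat. (\<forall>x. \<gamma> x \<le> m) \<and>
    (\<forall>x\<in>V. \<forall>y\<in>V. r y < r x \<and> C x y \<longrightarrow> \<gamma> x \<noteq> \<gamma> y)"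
proof -
  have "\<exists>\<gamma> :: 'a \<Rightarrow> nat. (\<forall>x. \<gamma> x \<le> m) \<and>
    (\<forall>x\<in>V. \<forall>y\<in>V. r x < n \<and> r y < r x \<and> C x y \<longrightarrow> \<gamma> x \<noteq> \<gamma> y)" for n
  proof (induction n)
    case 0
    show ?case by (intro exI[of _ "\<lambda>_. 0"]) simp
  next
    case (Suc n)
    then obtain \<gamma> :: "'a \<Rightarrow> nat" where \<gamma>: "\<forall>x. \<gamma> x \<le> m"
      "\<forall>x\<in>V. \<forall>y\<in>V. r x < n \<and> r y < r x \<and> C x y \<longrightarrow> \<gamma> x \<noteq> \<gamma> y" by (elim exE conjE)
    show ?case
    proof (cases "\<exists>x\<in>V. r x = n")
      case False
      then show ?thesis using \<gamma> by (intro exI[of _ \<gamma>]) (auto simp: less_Suc_eq)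
    next
      case True
      then obtain x where x: "x \<in> V" "r x = n" by blast
      let ?B = "{y \<in> V. r y < r x \<and> C x y}"
      have "card (\<gamma> ` ?B) \<le> m" using C[OF x(1)] card_image_le[of ?B \<gamma>] fin by simp
      then have "\<gamma> ` ?B \<noteq> {..m}" by (metis card_atMost not_less_eq_eq order_refl)
      then obtain a where a: "a \<le> m" "a \<notin> \<gamma> ` ?B" using \<gamma>(1) by blast
      have "(\<gamma>(x := a)) x' \<noteq> (\<gamma>(x := a)) y'"
        if h: "x' \<in> V" "y' \<in> V" "r x' < Suc n" "r y' < r x'" "C x' y'" for x' y'
      proof (cases "x' = x")
        case True
        then show ?thesis using h a(2) by auto
      next
        case False
        then have "r x' < n" using inj_onD[OF inj, of x' x] h x by (auto simp: less_Suc_eq)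
        then show ?thesis using False h \<gamma>(2) x by auto
      qed
      then show ?thesis using a(1) \<gamma>(1) by (intro exI[of _ "\<gamma>(x := a)"]) auto
    qed
  qed
  moreover obtain n where "\<forall>x\<in>V. r x < n"
    using finite_nat_set_iff_bounded[of "r ` V"] fin by auto
  ultimately show ?thesis by metis
qed

text \<open>The summands of \<open>m\<close> bound the conflicts to the left of \<open>x\<close>:
  left neighbours, vertices reached through a common right neighbour, and left neighbours of left
  neighbours. The exponent in \<open>2 ^ c\<close> is the depth of the laminar families.\<close>

lemma strong_odd_coloring_of_sparse_order:
  fixes r :: "'a \<Rightarrow> nat" and c d :: nat
  defines "m \<equiv> c + d + c * c"
  assumes fin: "finite V" and sym: "\<And>x y. E x y \<Longrightarrow> E y x" and irr: "\<And>x. \<not> E x x"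
    and inj: "inj_on r V"
    and cardL: "\<And>x. x \<in> V \<Longrightarrow> card {y \<in> V. r y < r x \<and> E x y} \<le> c"
    and cardW: "\<And>x. x \<in> V \<Longrightarrow>
      card {y \<in> V. r y < r x \<and> (\<exists>u\<in>V. r x < r u \<and> E u x \<and> E u y)} \<le> d"
  shows "\<exists>\<Phi> :: 'a \<Rightarrow> (nat \<times> (nat \<times> nat \<times> nat) set) \<times> nat.
    \<Phi> ` V \<subseteq> ({..m} \<times> Pow ({..m} \<times> {..m} \<times> {..d})) \<times> {..<2 ^ c} \<and>
    (\<forall>x\<in>V. \<forall>y\<in>V. E x y \<longrightarrow> \<Phi> x \<noteq> \<Phi> y) \<and>
    (\<forall>v\<in>V. \<forall>i. {u \<in> V. E v u \<and> \<Phi> u = i} = {} \<or> odd (card {u \<in> V. E v u \<and> \<Phi> u = i}))"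
proof -
  define L where "L x = {y \<in> V. r y < r x \<and> E x y}" for x
  define W where "W x = {y \<in> V. r y < r x \<and> (\<exists>u\<in>V. r x < r u \<and> E u x \<and> E u y)}" for x
  have finL: "finite (L x)" and finW: "finite (W x)" for x
    using fin by (auto simp: L_def W_def)
  \<comment> \<open>For \<open>y\<close> left of \<open>x\<close>, a common neighbour
    \<open>v\<close> right of \<open>y\<close> lies either left of \<open>x\<close>, so
    \<open>y\<close> is in \<open>L v\<close> with \<open>v\<close> in \<open>L x\<close>, or right
    of \<open>x\<close>, so \<open>y\<close> is in \<open>W x\<close>.\<close>
  define C where "C x y \<longleftrightarrow> E x y \<or> (\<exists>v\<in>V. r y < r v \<and> E v x \<and> E v y)" for x y
  have C_card: "card {y \<in> V. r y < r x \<and> C x y} \<le> m" if x: "x \<in> V" for x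
  proof -
    have "{y \<in> V. r y < r x \<and> C x y} \<subseteq> L x \<union> W x \<union> (\<Union>v\<in>L x. L v)"
    proof
      fix y assume "y \<in> {y \<in> V. r y < r x \<and> C x y}"
      then have y: "y \<in> V" "r y < r x" "C x y" by auto
      show "y \<in> L x \<union> W x \<union> (\<Union>v\<in>L x. L v)"
      proof (cases "E x y")
        case True
        then show ?thesis using y by (simp add: L_def)
      next
        case False
        then obtain v where v: "v \<in> V" "r y < r v" "E v x" "E v y" using y unfolding C_def by blast
        have "r v \<noteq> r x" using inj_onD[OF inj, of v x] v x irr by auto
        then consider "r v < r x" | "r x < r v" by linarith
        then show ?thesis
        proof cases
          case 1
          then have "v \<in> L x" "y \<in> L v" using v y sym[OF v(3)] by (auto simp: L_def)
          then show ?thesis by blast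
        next
          case 2
          then have "y \<in> W x" using v y by (auto simp: W_def)
          then show ?thesis by blast
        qed
      qed
    qed
    then have "card {y \<in> V. r y < r x \<and> C x y} \<le> card (L x \<union> W x \<union> (\<Union>v\<in>L x. L v))"
      using finL finW by (intro card_mono) auto
    also have "\<dots> \<le> card (L x) + card (W x) + card (\<Union>v\<in>L x. L v)"
      by (meson card_Un_le add_le_mono order_trans order_refl)
    also have "card (\<Union>v\<in>L x. L v) \<le> (\<Sum>v\<in>L x. card (L v))" using finL by (rule card_UN_le)
    also have "\<dots> \<le> (\<Sum>v\<in>L x. c)" using cardL by (intro sum_mono) (auto simp: L_def)
    also have "\<dots> \<le> c * c" using cardL[OF x] by (simp add: L_def)
    finally show ?thesis using cardL[OF x] cardW[OF x] unfolding m_def L_def W_def by linarith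
  qed
  have "\<exists>\<gamma> :: 'a \<Rightarrow> nat. (\<forall>x. \<gamma> x \<le> m) \<and>
    (\<forall>x\<in>V. \<forall>y\<in>V. r y < r x \<and> C x y \<longrightarrow> \<gamma> x \<noteq> \<gamma> y)"
    using fin inj C_card by (rule greedy_coloring)
  then obtain \<gamma> :: "'a \<Rightarrow> nat" where
    \<gamma>_le: "\<forall>x. \<gamma> x \<le> m" and
    \<gamma>: "\<forall>x\<in>V. \<forall>y\<in>V. r y < r x \<and> C x y \<longrightarrow> \<gamma> x \<noteq> \<gamma> y" by (elim exE conjE)
  have r_cases: "r x < r y \<or> r y < r x" if "x \<in> V" "y \<in> V" "x \<noteq> y" for x y
    using inj_onD[OF inj, of x y] that by fastforce
  have \<gamma>_proper: "\<gamma> x \<noteq> \<gamma> y" if xy: "x \<in> V" "y \<in> V" "E x y" for x y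
  proof -
    have "x \<noteq> y" using xy irr by blast
    moreover have "C x y" "C y x" using xy(3) sym[OF xy(3)] by (auto simp: C_def)
    ultimately show ?thesis using r_cases[of x y] xy \<gamma> by metis
  qed
  \<comment> \<open>Only \<open>y\<close> has to lie left of \<open>v\<close>: if \<open>x\<close>
    precedes \<open>y\<close>, then \<open>x\<close> is left of \<open>v\<close> too and the
    conflict \<open>C y x\<close> applies.\<close>
  have \<gamma>_nbrs: "\<gamma> x \<noteq> \<gamma> y"
    if xy: "v \<in> V" "x \<in> V" "y \<in> V" "x \<noteq> y" "E v x" "E v y" "r y < r v" for v x y
  proof (cases "r y < r x")
    case True
    then have "C x y" using xy unfolding C_def by blast
    then show ?thesis using \<gamma> True xy by blast
  next
    case False
    then have "r x < r y" using r_cases[of x y] xy by blast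
    moreover from this have "C y x" using xy unfolding C_def by (meson less_trans)
    ultimately have "\<gamma> y \<noteq> \<gamma> x" using \<gamma> xy by blast
    then show ?thesis by simp
  qed
  have "\<exists>f. inj_on f (W v) \<and> f ` W v \<subseteq> {..d}" if v: "v \<in> V" for v
  proof -
    obtain f where f: "bij_betw f (W v) {0..<card (W v)}"
      using ex_bij_betw_finite_nat[OF finW] by blast
    have "{0..<card (W v)} \<subseteq> {..d}" using cardW[OF v] by (auto simp: W_def)
    then show ?thesis using f unfolding bij_betw_def by blast
  qed
  then obtain idx where idx: "\<And>v. v \<in> V \<Longrightarrow> inj_on (idx v) (W v) \<and> idx v ` W v \<subseteq> {..d}"
    by metis
  \<comment> \<open>The vertex \<open>u\<close> lies right of \<open>v\<close> and is adjacent to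
    \<open>v\<close> and \<open>w\<close>, so \<open>idx v w\<close> is a bounded name of
    \<open>w\<close> relative to \<open>v\<close>.\<close>
  have pair_W: "w \<in> W v" if "u \<in> V" "v \<in> L u" "w \<in> L u" "r w < r v" for u v w
    using that unfolding L_def W_def by blast
  define T where
    "T u = {(\<gamma> v, \<gamma> w, idx v w) | v w. v \<in> L u \<and> w \<in> L u \<and> r w < r v}" for u
  define \<tau> where "\<tau> u = (\<gamma> u, T u)" for u
  define R where "R s v = {u \<in> V. \<tau> u = s \<and> v \<in> L u}" for s v
  txt \<open>
    Among the left neighbours of a vertex \<open>\<gamma>\<close> determines \<open>v\<close>, and then \<open>idx v w\<close> determines \<open>w\<close>; so the
    signature of \<open>u\<close> forces every vertex of \<open>R s v\<close> to be adjacent to \<open>w\<close> as well.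
  \<close>
  have nested: "R s v \<subseteq> R s w"
    if u: "u \<in> R s v" "u \<in> R s w" and wv: "r w < r v" for s u v w
  proof
    fix u' assume u': "u' \<in> R s v"
    have V: "u \<in> V" "u' \<in> V" "v \<in> L u" "w \<in> L u" "v \<in> L u'"
      using u u' unfolding R_def by auto
    have "(\<gamma> v, \<gamma> w, idx v w) \<in> T u" using V wv unfolding T_def by blast
    also have "T u = T u'" using u u' unfolding R_def \<tau>_def by auto
    finally obtain v' w' where vw': "v' \<in> L u'" "w' \<in> L u'" "r w' < r v'"
      "\<gamma> v' = \<gamma> v" "\<gamma> w' = \<gamma> w" "idx v' w' = idx v w" unfolding T_def by auto
    have "v' = v" using \<gamma>_nbrs[of u' v' v] V vw' unfolding L_def by blast
    moreover have "w \<in> W v" "w' \<in> W v'" using pair_W V vw' wv by blast+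
    moreover have "v \<in> V" using V by (simp add: L_def)
    ultimately have "w' = w" using idx[of v] vw'(6) by (metis inj_onD)
    then show "u' \<in> R s w" using u' vw' unfolding R_def by blast
  qed
  have "\<exists>\<chi> :: 'a \<Rightarrow> nat. (\<forall>x. \<chi> x < 2 ^ c) \<and>
    (\<forall>A\<in>R s ` V. \<forall>i. {x \<in> A. \<chi> x = i} = {} \<or> odd (card {x \<in> A. \<chi> x = i}))" for s
  proof (rule laminar_odd_coloring)
    show "A \<inter> B = {} \<or> A \<subseteq> B \<or> B \<subseteq> A" if AB: "A \<in> R s ` V" "B \<in> R s ` V" for A B
    proof -
      obtain v w where vw: "v \<in> V" "w \<in> V" "A = R s v" "B = R s w" using AB by blast
      show ?thesis
      proof (cases "A \<inter> B = {} \<or> v = w")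
        case True
        then show ?thesis using vw by blast
      next
        case False
        then obtain u where "u \<in> R s v" "u \<in> R s w" using vw by blast
        then show ?thesis using nested[of u s v w] nested[of u s w v] r_cases[of v w] False vw
          by blast
      qed
    qed
    \<comment> \<open>A member containing \<open>x\<close> is \<open>R s v\<close> for some left
      neighbour \<open>v\<close> of \<open>x\<close>.\<close>
    show "card {A \<in> R s ` V. x \<in> A} \<le> c" for x
    proof (cases "x \<in> V")
      case True
      have "{A \<in> R s ` V. x \<in> A} \<subseteq> R s ` L x" by (auto simp: R_def)
      then have "card {A \<in> R s ` V. x \<in> A} \<le> card (L x)"
        using finL[of x] by (meson card_image_le card_mono finite_imageI order_trans)
      then show ?thesis using cardL[OF True] by (simp add: L_def)
    next
      case False
      then have "{A \<in> R s ` V. x \<in> A} = {}" by (auto simp: R_def)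
      then show ?thesis by (simp only: card.empty)
    qed
  qed (use fin in \<open>auto simp: R_def\<close>)
  then have "\<exists>\<chi> :: _ \<Rightarrow> 'a \<Rightarrow> nat. \<forall>s. (\<forall>x. \<chi> s x < 2 ^ c) \<and>
    (\<forall>A\<in>R s ` V. \<forall>i. {x \<in> A. \<chi> s x = i} = {} \<or> odd (card {x \<in> A. \<chi> s x = i}))"
    by (intro choice allI)
  then obtain \<chi> :: "_ \<Rightarrow> 'a \<Rightarrow> nat" where \<chi>: "\<forall>s. (\<forall>x. \<chi> s x < 2 ^ c) \<and>
    (\<forall>A\<in>R s ` V. \<forall>i. {x \<in> A. \<chi> s x = i} = {} \<or> odd (card {x \<in> A. \<chi> s x = i}))" ..
  have \<chi>_lt: "\<chi> s x < 2 ^ c" for s x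
    using spec[OF \<chi>, of s] by (elim conjE allE)
  have \<chi>_odd: "{x \<in> A. \<chi> s x = i} = {} \<or> odd (card {x \<in> A. \<chi> s x = i})" if "A \<in> R s ` V" for s A i
    using bspec[OF conjunct2[OF spec[OF \<chi>, of s]] that] by (rule spec)
  define \<Phi> where "\<Phi> u = (\<tau> u, \<chi> (\<tau> u) u)" for u
  show ?thesis
  proof (intro exI[of _ \<Phi>] conjI ballI impI allI)
    have "T u \<subseteq> {..m} \<times> {..m} \<times> {..d}" if u: "u \<in> V" for u
    proof
      fix t assume "t \<in> T u"
      then obtain v w where vw: "t = (\<gamma> v, \<gamma> w, idx v w)" "v \<in> L u" "w \<in> L u" "r w < r v"
        unfolding T_def by blast
      then have "w \<in> W v" using pair_W u by blast
      moreover have "v \<in> V" using vw by (simp add: L_def)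
      ultimately have "idx v w \<le> d" using idx[of v] by auto
      then show "t \<in> {..m} \<times> {..m} \<times> {..d}" using vw \<gamma>_le by simp
    qed
    then show "\<Phi> ` V \<subseteq> ({..m} \<times> Pow ({..m} \<times> {..m} \<times> {..d})) \<times> {..<2 ^ c}"
      using \<gamma>_le \<chi>_lt unfolding \<Phi>_def \<tau>_def by auto
  next
    fix x y assume "x \<in> V" "y \<in> V" "E x y"
    then show "\<Phi> x \<noteq> \<Phi> y" using \<gamma>_proper[of x y] by (auto simp: \<Phi>_def \<tau>_def)
  next
    fix v and i :: "(nat \<times> (nat \<times> nat \<times> nat) set) \<times> nat"
    assume v: "v \<in> V"
    obtain s j where i: "i = (s, j)" by (cases i)
    let ?N = "{u \<in> V. E v u \<and> \<Phi> u = i}"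
    show "?N = {} \<or> odd (card ?N)"
    \<comment> \<open>A left neighbour in the class is separated by \<open>\<gamma>\<close> from all
      other neighbours, so it is alone. Otherwise the class lies to the right of \<open>v\<close>
      and is a color class of the laminar member \<open>R s v\<close>.\<close>
    proof (cases "\<exists>w\<in>?N. r w < r v")
      case True
      then obtain w where w: "w \<in> ?N" "r w < r v" by blast
      have "u = w" if "u \<in> ?N" for u
      proof (rule ccontr)
        assume "u \<noteq> w"
        then have "\<gamma> u \<noteq> \<gamma> w" using \<gamma>_nbrs[of v u w] v w that by blast
        then show False using w that by (auto simp: \<Phi>_def \<tau>_def)
      qed
      then have "?N = {w}" using w by blast
      then show ?thesis by simp
    next
      case False
      have "r v < r u" if "u \<in> ?N" for u
        using False r_cases[of u v] irr[of v] v that by blast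
      then have "?N = {u \<in> R s v. \<chi> s u = j}"
        using v sym unfolding i R_def \<Phi>_def L_def by blast
      moreover have "R s v \<in> R s ` V" using v by blast
      ultimately show ?thesis using \<chi>_odd[of "R s v" s j] by simp
    qed
  qed
qed

section \<open>Transfer to graphs and minor-closed classes\<close>

abbreviation adjacent :: "'a pair_pre_digraph \<Rightarrow> 'a \<Rightarrow> 'a \<Rightarrow> bool" where
  "adjacent G u v \<equiv> (u, v) \<in> parcs G"

lemma (in pair_graph) adjacent_sym: "adjacent G u v \<Longrightarrow> adjacent G v u"
  using pair_sym_arcs by (auto simp: symmetric_def dest: symD)

lemma (in pair_graph) adjacent_irrefl: "\<not> adjacent G v v"
  using pair_no_loops by fastforce

text \<open>The finite color set \<open>Col\<close> depends on \<open>n\<close> alone, so its size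
  bounds all these graphs uniformly.\<close>

lemma strong_odd_chromatic_number_bounded:
  "\<exists>t. \<forall>G :: 'a pair_pre_digraph. pair_graph G \<and> \<not> clique_minor (adjacent G) (pverts G) n
    \<longrightarrow> strong_odd_chromatic_number G \<le> t"
proof -
  define c where "c = sparse_order_bound n"
  define d where "d = reach_bound n"
  define m where "m = c + d + c * c"
  define Col :: "((nat \<times> (nat \<times> nat \<times> nat) set) \<times> nat) set"
    where "Col = ({..m} \<times> Pow ({..m} \<times> {..m} \<times> {..d})) \<times> {..<2 ^ c}"
  have "finite Col" by (simp add: Col_def)
  then obtain f where f: "bij_betw f Col {0..<card Col}" using ex_bij_betw_finite_nat by blast
  show ?thesis
  proof (intro exI[of _ "card Col"] allI impI)
    fix G :: "'a pair_pre_digraph"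
    assume G: "pair_graph G \<and> \<not> clique_minor (adjacent G) (pverts G) n"
    then interpret pair_graph G by blast
    have "\<exists>r :: 'a \<Rightarrow> nat. inj_on r (pverts G) \<and>
      (\<forall>x\<in>pverts G. card {y \<in> pverts G. r y < r x \<and> adjacent G x y} \<le> c \<and>
        card {y \<in> pverts G. r y < r x \<and>
          (\<exists>u\<in>pverts G. r x < r u \<and> adjacent G u x \<and> adjacent G u y)} \<le> d)"
      unfolding c_def d_def
      by (rule exists_sparse_order[where E = "adjacent G",
          OF pair_finite_verts adjacent_sym adjacent_irrefl conjunct2[OF G]])
    then obtain r :: "'a \<Rightarrow> nat" where r: "inj_on r (pverts G)"
      "\<forall>x\<in>pverts G. card {y \<in> pverts G. r y < r x \<and> adjacent G x y} \<le> c \<and>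
        card {y \<in> pverts G. r y < r x \<and>
          (\<exists>u\<in>pverts G. r x < r u \<and> adjacent G u x \<and> adjacent G u y)} \<le> d"
      by (elim exE conjE)
    have "\<exists>\<Phi>. \<Phi> ` pverts G \<subseteq> Col \<and>
      (\<forall>x\<in>pverts G. \<forall>y\<in>pverts G. adjacent G x y \<longrightarrow> \<Phi> x \<noteq> \<Phi> y) \<and>
      (\<forall>v\<in>pverts G. \<forall>i. {u \<in> pverts G. adjacent G v u \<and> \<Phi> u = i} = {} \<or>
        odd (card {u \<in> pverts G. adjacent G v u \<and> \<Phi> u = i}))"
      unfolding Col_def m_def
      by (rule strong_odd_coloring_of_sparse_order[where E = "adjacent G",
            OF pair_finite_verts adjacent_sym adjacent_irrefl r(1)
            conjunct1[OF bspec[OF r(2)]] conjunct2[OF bspec[OF r(2)]]])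
    then obtain \<Phi> where \<Phi>: "\<Phi> ` pverts G \<subseteq> Col"
      "\<forall>x\<in>pverts G. \<forall>y\<in>pverts G. adjacent G x y \<longrightarrow> \<Phi> x \<noteq> \<Phi> y"
      "\<forall>v\<in>pverts G. \<forall>i. {u \<in> pverts G. adjacent G v u \<and> \<Phi> u = i} = {} \<or>
        odd (card {u \<in> pverts G. adjacent G v u \<and> \<Phi> u = i})" by (elim exE conjE)
    \<comment> \<open>\<open>Suc\<close> shifts the numbering of \<open>Col\<close> from 0 to the
      colors \<open>{1..card Col}\<close>.\<close>
    define \<phi> where "\<phi> u = Suc (f (\<Phi> u))" for u
    have \<phi>_eq: "\<phi> u = \<phi> v \<longleftrightarrow> \<Phi> u = \<Phi> v" if "u \<in> pverts G" "v \<in> pverts G" for u v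
      using inj_onD[OF bij_betw_imp_inj_on[OF f], of "\<Phi> u" "\<Phi> v"] \<Phi>(1) that by (auto simp: \<phi>_def)
    have range: "\<phi> u \<in> {1..card Col}" if "u \<in> pverts G" for u
    proof -
      have "\<Phi> u \<in> Col" using \<Phi>(1) that by blast
      then show ?thesis using bij_betwE[OF f] by (simp add: \<phi>_def Suc_le_eq)
    qed
    have "card {u \<in> neighbors G v. \<phi> u = i} = 0 \<or> odd (card {u \<in> neighbors G v. \<phi> u = i})"
      if v: "v \<in> pverts G" for v i
    proof (cases "{u \<in> neighbors G v. \<phi> u = i} = {}")
      case False
      then obtain w where w: "w \<in> pverts G" "adjacent G v w" "\<phi> w = i"
        unfolding neighbors_def using in_arcsD2 by blast
      have eq: "{u \<in> neighbors G v. \<phi> u = i} = {u \<in> pverts G. adjacent G v u \<and> \<Phi> u = \<Phi> w}"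
        using \<phi>_eq w unfolding neighbors_def by (auto dest: in_arcsD2)
      have "odd (card {u \<in> neighbors G v. \<phi> u = i})"
        using spec[OF bspec[OF \<Phi>(3) v], of "\<Phi> w"] False unfolding eq by meson
      then show ?thesis ..
    qed (simp only: card.empty simp_thms)
    moreover have "proper_coloring G (card Col) \<phi>"
      unfolding proper_coloring_def
    proof (intro conjI subsetI ballI)
      fix i assume "i \<in> \<phi> ` pverts G"
      then show "i \<in> {1..card Col}" using range by blast
    next
      fix e assume "e \<in> parcs G"
      moreover obtain x y where "e = (x, y)" by (cases e)
      ultimately show "case e of (x, y) \<Rightarrow> \<phi> x \<noteq> \<phi> y"
        using \<phi>_eq[of x y] \<Phi>(2) in_arcsD1[of x y] in_arcsD2[of x y] by simp
    qed
    ultimately have "strong_odd_coloring G (card Col) \<phi>"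
      unfolding strong_odd_coloring_def by blast
    then show "strong_odd_chromatic_number G \<le> card Col"
      unfolding strong_odd_chromatic_number_def by (intro Least_le) blast
  qed
qed

text \<open>If the set reachable from \<open>u\<close> inside \<open>B\<close> were not all of
  \<open>B\<close>, an edge would leave it. \<open>connected\<close> refers to the symmetric
  closure, hence \<open>mk_symmetric\<close>.\<close>

lemma connected_induce_subgraph_if_linked:
  assumes linked: "linked (adjacent G) B"
  shows "connected (with_proj G \<restriction> B)"
proof -
  let ?M = "mk_symmetric (with_proj G \<restriction> B)"
  have verts: "pverts ?M = B" by (simp add: mk_symmetric_def)
  have arcs: "(x, y) \<in> parcs ?M" if "x \<in> B" "y \<in> B" "adjacent G x y" for x y
    using that by (auto simp: mk_symmetric_def induce_subgraph_def)
  have "(u, v) \<in> rtrancl_on B (parcs ?M)" if uv: "u \<in> B" "v \<in> B" for u v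
  proof (rule ccontr)
    assume no: "(u, v) \<notin> rtrancl_on B (parcs ?M)"
    define X where "X = {w \<in> B. (u, w) \<in> rtrancl_on B (parcs ?M)}"
    have "X \<subseteq> B \<and> X \<noteq> {} \<and> X \<noteq> B"
      using uv no unfolding X_def by blast
    then have "\<exists>x\<in>X. \<exists>y\<in>B - X. adjacent G x y" using linked unfolding linked_def by presburger
    then obtain x y where "x \<in> X" "y \<in> B - X" "adjacent G x y" by blast
    then show False using arcs[of x y] unfolding X_def
      by (auto intro: rtrancl_on_into_rtrancl_on)
  qed
  then show ?thesis
    using linked unfolding connected_def strongly_connected_def reachable_def
    by (simp add: verts linked_def)
qed

text \<open>A graph is a subgraph of the complete graph on its vertices; numbering them by
  \<open>f\<close> picks the branch sets.\<close>

lemma is_minor_if_clique_minor: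
  assumes "pair_graph H"
    and "clique_minor (adjacent G) (pverts G) (card (pverts H))"
  shows "is_minor H G"
proof -
  interpret H: pair_graph H by fact
  obtain f where f: "bij_betw f (pverts H) {0..<card (pverts H)}"
    using ex_bij_betw_finite_nat[OF H.pair_finite_verts] by blast
  have f_lt: "f x < card (pverts H)" if "x \<in> pverts H" for x
    using bij_betwE[OF f] that by auto
  have f_inj: "f x \<noteq> f y" if "x \<in> pverts H" "y \<in> pverts H" "x \<noteq> y" for x y
    using f that by (meson bij_betw_def inj_onD)
  obtain B where "clique_model (adjacent G) (pverts G) (card (pverts H)) B"
    using assms(2) unfolding clique_minor_def ..
  note B = clique_modelD[OF this]
  show ?thesis unfolding is_minor_def
  proof (intro exI[of _ "B \<circ> f"] conjI ballI impI)
    fix x assume x: "x \<in> pverts H"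
    show "(B \<circ> f) x \<subseteq> pverts G" using B(1)[OF f_lt[OF x]] by simp
    show "connected (with_proj G \<restriction> (B \<circ> f) x)"
      using B(1)[OF f_lt[OF x]] by (simp add: connected_induce_subgraph_if_linked)
  next
    fix x y assume "x \<in> pverts H" "y \<in> pverts H" "x \<noteq> y"
    then show "(B \<circ> f) x \<inter> (B \<circ> f) y = {}" using B(2)[of "f x" "f y"] f_lt f_inj by simp
  next
    fix e assume "e \<in> parcs H"
    moreover obtain x y where e: "e = (x, y)" by (cases e)
    ultimately have "x \<in> pverts H" "y \<in> pverts H" "x \<noteq> y"
      using H.in_arcsD1 H.in_arcsD2 H.adjacent_irrefl by blast+
    then show "case e of (x, y) \<Rightarrow> \<exists>u\<in>(B \<circ> f) x. \<exists>v\<in>(B \<circ> f) y. (u, v) \<in> parcs G"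
      using B(2)[of "f x" "f y"] f_lt f_inj e by simp
  qed
qed

theorem theorem4:
  fixes \<G> :: "'a pair_pre_digraph set"
  assumes "\<forall>G\<in>\<G>. pair_graph G"
    and "minor_closed \<G>"
    and "proper_class \<G>"
  shows "\<exists>c. \<forall>G\<in>\<G>. strong_odd_chromatic_number G \<le> c"
proof -
  \<comment> \<open>Properness supplies an excluded graph \<open>H\<close>. A member with a clique
    minor on \<open>card (pverts H)\<close> vertices would have \<open>H\<close> as a minor and
    force it into the class.\<close>
  obtain H where H: "pair_graph H" "H \<notin> \<G>"
    using assms(1,3) unfolding proper_class_def by blast
  have "\<not> clique_minor (adjacent G) (pverts G) (card (pverts H))" if "G \<in> \<G>" for G
    using is_minor_if_clique_minor[of H G] assms(2) that H unfolding minor_closed_def by blast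
  then show ?thesis
    using strong_odd_chromatic_number_bounded[of "card (pverts H)"] assms(1) by metis
qed

end
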